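(* On $\mathbb{R}$ let $c(x,y)=|x-y|^2$ and let $\varepsilon>0$. Then $S_\varepsilon^\alpha$ fails to satisfy the triangle inequality for any $\alpha\ge\frac12$; that is, for every $\alpha\ge\frac12$ there exist probability measures $\mu_0,\mu_1,\mu_2$ on $\mathbb{R}$ with finite second moment such that $$S_\varepsilon(\mu_0,\mu_2)^\alpha>S_\varepsilon(\mu_0,\mu_1)^\alpha+S_\varepsilon(\mu_1,\mu_2)^\alpha .$$
   Context: $\mathrm{OT}_\varepsilon(\mu,\nu)=\inf_{\pi\in\Pi(\mu,\nu)}\iint c\,d\pi+\varepsilon\,\mathrm{KL}(\pi\,|\,\mu\otimes\nu)$, where $\Pi(\mu,\nu)$ is the set of couplings of $\mu,\nu$ and $\mathrm{KL}$ is the Kullback--Leibler divergence ($+\infty$ if $\pi\not\ll\mu\otimes\nu$). Sinkhorn divergence: $S_\varepsilon(\mu,\nu)=\mathrm{OT}_\varepsilon(\mu,\nu)-\frac12\mathrm{OT}_\varepsilon(\mu,\mu)-\frac12\mathrm{OT}_\varepsilon(\nu,\nu)\ (\ge 0)$. *)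

theory Defs
  imports "HOL-Probability.Probability"
begin

definition couplings :: "'a measure \<Rightarrow> 'b measure \<Rightarrow> ('a \<times> 'b) measure set" where
  "couplings \<mu> \<nu> = {\<pi>. sets \<pi> = sets (\<mu> \<Otimes>\<^sub>M \<nu>) \<and> distr \<pi> \<mu> fst = \<mu> \<and> distr \<pi> \<nu> snd = \<nu>}"

text \<open>
  \<^term>\<open>KL_ext P Q\<close> is \<open>KL(P | Q)\<close> with the natural logarithm, the reference measure \<open>Q\<close> coming
  second; \<^const>\<open>KL_divergence\<close> takes the reference measure first.  For probability measures with
  \<open>P \<lless> Q\<close>, the negative part of \<open>log (dP/dQ)\<close> is always \<open>P\<close>-integrable, so
  non-integrability means that the integral is \<open>\<infinity>\<close>.
\<close>
definition KL_ext :: "'a measure \<Rightarrow> 'a measure \<Rightarrow> ereal" where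
  "KL_ext P Q =
     (if absolutely_continuous Q P \<and> integrable P (entropy_density (exp 1) Q P)
      then ereal (KL_divergence (exp 1) Q P) else \<infinity>)"

definition entropic_OT ::
  "('a \<Rightarrow> 'a \<Rightarrow> ennreal) \<Rightarrow> real \<Rightarrow> 'a measure \<Rightarrow> 'a measure \<Rightarrow> ereal" where
  "entropic_OT c \<epsilon> \<mu> \<nu> =
     (INF \<pi>\<in>couplings \<mu> \<nu>.
        enn2ereal (\<integral>\<^sup>+ z. c (fst z) (snd z) \<partial>\<pi>) + ereal \<epsilon> * KL_ext \<pi> (\<mu> \<Otimes>\<^sub>M \<nu>))"

definition sinkhorn_divergence ::
  "('a \<Rightarrow> 'a \<Rightarrow> ennreal) \<Rightarrow> real \<Rightarrow> 'a measure \<Rightarrow> 'a measure \<Rightarrow> ereal" where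
  "sinkhorn_divergence c \<epsilon> \<mu> \<nu> =
     entropic_OT c \<epsilon> \<mu> \<nu> - ereal (1/2) * entropic_OT c \<epsilon> \<mu> \<mu> - ereal (1/2) * entropic_OT c \<epsilon> \<nu> \<nu>"

definition quadratic_cost :: "real \<Rightarrow> real \<Rightarrow> ennreal" where
  "quadratic_cost x y = ennreal (\<bar>x - y\<bar>\<^sup>2)"

definition prob_measures2 :: "real measure set" where
  "prob_measures2 = {\<mu>. sets \<mu> = sets borel \<and> prob_space \<mu> \<and> integrable \<mu> (\<lambda>x. x\<^sup>2)}"

lemma prob_space_coupling:
  assumes "prob_space \<mu>" "\<pi> \<in> couplings \<mu> \<nu>"
  shows "prob_space \<pi>"
proof -
  have s: "sets \<pi> = sets (\<mu> \<Otimes>\<^sub>M \<nu>)" and d: "distr \<pi> \<mu> fst = \<mu>"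
    using assms(2) by (auto simp: couplings_def)
  have "fst \<in> measurable \<pi> \<mu>"
    using measurable_cong_sets[OF s refl] by auto
  then show ?thesis
    using assms(1) d prob_space_distrD by metis
qed

lemma KL_ext_nonneg:
  assumes "prob_space P" "prob_space Q" "sets P = sets Q"
  shows "0 \<le> KL_ext P Q"
proof (cases "absolutely_continuous Q P \<and> integrable P (entropy_density (exp 1) Q P)")
  case True
  interpret Q: prob_space Q by fact
  interpret P: prob_space P by fact
  interpret I: information_space Q "exp 1" by standard simp
  have "finite_measure P" by unfold_locales
  from Q.real_RN_deriv[OF this _ assms(3)] True obtain D
    where D: "D \<in> borel_measurable Q" "AE x in Q. RN_deriv Q P x = ennreal (D x)"
      "AE x in P. 0 < D x" "\<And>x. 0 \<le> D x"
    by auto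
  have "P = density Q (RN_deriv Q P)"
    using True assms(3) by (intro Q.density_RN_deriv[symmetric]) auto
  also have "\<dots> = density Q D"
    using D by (auto intro!: density_cong)
  finally have P: "P = density Q D" .
  have AEP: "AE x in P. RN_deriv Q P x = ennreal (D x)"
    using absolutely_continuous_AE[OF assms(3) _ D(2)] True by simp
  have eq: "AE x in P. entropy_density (exp 1) Q P x = log (exp 1) (D x)"
    using AEP by eventually_elim (simp add: entropy_density_def D(4))
  have "D \<in> borel_measurable P"
    using D(1) measurable_cong_sets[OF assms(3) refl] by blast
  then have "integrable P (\<lambda>x. log (exp 1) (D x))"
    using True eq by (subst integrable_cong_AE[symmetric, where f="entropy_density (exp 1) Q P"]) auto
  then have "integrable (density Q D) (\<lambda>x. log (exp 1) (D x))"
    unfolding P .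
  then have "integrable Q (\<lambda>x. D x * log (exp 1) (D x))"
    using D by (subst (asm) integrable_real_density) auto
  then have "0 \<le> KL_divergence (exp 1) Q (density Q D)"
    using D assms(1) P by (intro I.KL_nonneg) auto
  then show ?thesis
    using True P by (auto simp: KL_ext_def)
next
  case False
  then show ?thesis
    unfolding KL_ext_def by (simp only: if_False) simp
qed

lemma KL_ext_self:
  assumes "prob_space P"
  shows "KL_ext P P = 0"
proof -
  interpret P: prob_space P by fact
  have "AE x in P. 1 = RN_deriv P P x"
    by (rule P.RN_deriv_unique) (auto simp: density_1)
  then have "AE x in P. entropy_density (exp 1) P P x = 0"
    by (auto simp: entropy_density_def)
  then have "integrable P (entropy_density (exp 1) P P)"
    by (subst integrable_cong_AE[where g="\<lambda>_. 0"])
       (auto simp: entropy_density_def)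
  then show ?thesis
    by (simp add: KL_ext_def absolutely_continuous_def P.KL_same_eq_0)
qed

lemma pair_measure_coupling:
  assumes "prob_space \<mu>" "prob_space \<nu>"
  shows "\<mu> \<Otimes>\<^sub>M \<nu> \<in> couplings \<mu> \<nu>"
proof -
  interpret M: prob_space \<mu> by fact
  interpret N: prob_space \<nu> by fact
  interpret pair_prob_space \<mu> \<nu> by unfold_locales
  have "distr (\<mu> \<Otimes>\<^sub>M \<nu>) \<mu> fst = \<mu>" by (rule N.distr_pair_fst)
  moreover have "distr (\<mu> \<Otimes>\<^sub>M \<nu>) \<nu> snd = \<nu>"
  proof (rule measure_eqI)
    fix A assume "A \<in> sets (distr (\<mu> \<Otimes>\<^sub>M \<nu>) \<nu> snd)"
    then have A: "A \<in> sets \<nu>" by simp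
    have "snd -` A \<inter> space (\<mu> \<Otimes>\<^sub>M \<nu>) = space \<mu> \<times> A"
      using sets.sets_into_space[OF A] by (auto simp: space_pair_measure)
    then show "emeasure (distr (\<mu> \<Otimes>\<^sub>M \<nu>) \<nu> snd) A = emeasure \<nu> A"
      using A by (simp add: emeasure_distr N.emeasure_pair_measure_Times M.emeasure_space_1)
  qed simp
  ultimately show ?thesis by (simp add: couplings_def)
qed

text \<open>
  On measures with finite second moment all three terms of the Sinkhorn divergence are finite, so
  no \<open>\<infinity> - \<infinity>\<close> occurs and \<^const>\<open>real_of_ereal\<close> loses nothing there.
\<close>
lemma entropic_OT_finite:
  assumes "0 < \<epsilon>" "\<mu> \<in> prob_measures2" "\<nu> \<in> prob_measures2"
  shows "0 \<le> entropic_OT quadratic_cost \<epsilon> \<mu> \<nu>" "entropic_OT quadratic_cost \<epsilon> \<mu> \<nu> < \<infinity>"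
proof -
  have [measurable_cong]: "sets \<mu> = sets borel" "sets \<nu> = sets borel"
    and i: "integrable \<mu> (\<lambda>x. x\<^sup>2)" "integrable \<nu> (\<lambda>x. x\<^sup>2)"
    and p: "prob_space \<mu>" "prob_space \<nu>"
    using assms by (auto simp: prob_measures2_def)
  interpret M: prob_space \<mu> by fact
  interpret N: prob_space \<nu> by fact
  interpret pair_prob_space \<mu> \<nu> by unfold_locales
  have pp: "prob_space (\<mu> \<Otimes>\<^sub>M \<nu>)" by unfold_locales
  show "0 \<le> entropic_OT quadratic_cost \<epsilon> \<mu> \<nu>"
    unfolding entropic_OT_def
  proof (rule INF_greatest)
    fix \<pi> assume c: "\<pi> \<in> couplings \<mu> \<nu>"
    have "0 \<le> KL_ext \<pi> (\<mu> \<Otimes>\<^sub>M \<nu>)"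
      using c prob_space_coupling[OF p(1) c] pp by (intro KL_ext_nonneg) (auto simp: couplings_def)
    then show "0 \<le> enn2ereal (\<integral>\<^sup>+ z. quadratic_cost (fst z) (snd z) \<partial>\<pi>)
        + ereal \<epsilon> * KL_ext \<pi> (\<mu> \<Otimes>\<^sub>M \<nu>)"
      using assms(1) by (intro add_nonneg_nonneg) auto
  qed
  have "entropic_OT quadratic_cost \<epsilon> \<mu> \<nu>
      \<le> enn2ereal (\<integral>\<^sup>+ z. quadratic_cost (fst z) (snd z) \<partial>(\<mu> \<Otimes>\<^sub>M \<nu>))"
    unfolding entropic_OT_def
    by (rule INF_lower2[OF pair_measure_coupling[OF p]]) (simp add: KL_ext_self[OF pp])
  also have "(\<integral>\<^sup>+ z. quadratic_cost (fst z) (snd z) \<partial>(\<mu> \<Otimes>\<^sub>M \<nu>)) < \<infinity>"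
  proof -
    have b: "(a - b)\<^sup>2 \<le> 2 * a\<^sup>2 + 2 * b\<^sup>2" for a b :: real
      using zero_le_power2[of "a + b"] by (simp add: power2_eq_square algebra_simps)
    have "(\<integral>\<^sup>+ z. quadratic_cost (fst z) (snd z) \<partial>(\<mu> \<Otimes>\<^sub>M \<nu>))
        \<le> (\<integral>\<^sup>+ z. ennreal (2 * (fst z)\<^sup>2) + ennreal (2 * (snd z)\<^sup>2) \<partial>(\<mu> \<Otimes>\<^sub>M \<nu>))"
      unfolding quadratic_cost_def
      by (intro nn_integral_mono) (use b in \<open>auto simp flip: ennreal_plus intro!: ennreal_leI\<close>)
    also have "\<dots> = (\<integral>\<^sup>+ x. \<integral>\<^sup>+ y. ennreal (2 * x\<^sup>2) + ennreal (2 * y\<^sup>2) \<partial>\<nu> \<partial>\<mu>)"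
      by (subst N.nn_integral_fst[symmetric]) auto
    also have "\<dots> = (\<integral>\<^sup>+ x. ennreal (2 * x\<^sup>2) \<partial>\<mu>) + (\<integral>\<^sup>+ y. ennreal (2 * y\<^sup>2) \<partial>\<nu>)"
      by (simp add: nn_integral_add N.emeasure_space_1 M.emeasure_space_1)
    also have "\<dots> < \<infinity>"
      using i by (simp add: nn_integral_eq_integral)
    finally show ?thesis .
  qed
  then have "enn2ereal (\<integral>\<^sup>+ z. quadratic_cost (fst z) (snd z) \<partial>(\<mu> \<Otimes>\<^sub>M \<nu>)) < \<infinity>"
    by (metis enn2ereal_top infinity_ennreal_def less_ennreal.rep_eq top_ereal_def)
  finally show "entropic_OT quadratic_cost \<epsilon> \<mu> \<nu> < \<infinity>" .
qed

lemma sinkhorn_divergence_finite: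
  assumes "0 < \<epsilon>" "\<mu> \<in> prob_measures2" "\<nu> \<in> prob_measures2"
  shows "\<bar>sinkhorn_divergence quadratic_cost \<epsilon> \<mu> \<nu>\<bar> \<noteq> \<infinity>"
proof -
  have "\<bar>entropic_OT quadratic_cost \<epsilon> a b\<bar> \<noteq> \<infinity>"
    if "a \<in> prob_measures2" "b \<in> prob_measures2" for a b
    using entropic_OT_finite[OF assms(1) that] by auto
  from this[OF assms(2,3)] this[OF assms(2,2)] this[OF assms(3,3)]
  show ?thesis
    unfolding sinkhorn_divergence_def
    by (cases "entropic_OT quadratic_cost \<epsilon> \<mu> \<nu>"; cases "entropic_OT quadratic_cost \<epsilon> \<mu> \<mu>";
        cases "entropic_OT quadratic_cost \<epsilon> \<nu> \<nu>") auto
qed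

end

(* For nu_a = (delta_a + delta_(-a))/2 the Schroedinger system can be solved explicitly and gives
   OT(nu_a, nu_b) = a^2 + b^2 - eps l(2ab/eps) with l = ln o cosh.  Along nu_0, nu_s, nu_t
   the triangle inequality for the square root of S fails as soon as
   l(2st/eps)^2 > l(2s^2/eps) l(2t^2/eps), that is, by the strict log-log concavity of l; we take
   s = sqrt eps / 2 and t = 2 sqrt eps.  Failure for larger exponents follows since
   x powr (2 alpha) is superadditive. *)
theory Submission
  imports Defs
begin

section \<open>Gibbs variational principle for relative entropy\<close>

text \<open>This is the easy half of the Donsker-Varadhan formula, later the lower bound on the
  entropic cost. With \<open>D\<close> the density of \<open>P\<close>, a Young inequality is
  integrated over \<open>Q\<close>; the normalisations of \<open>D\<close> and of
  \<open>exp (\<phi> x)\<close> absorb its linear and exponential terms.\<close>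

lemma KL_ext_ge_Gibbs:
  assumes "prob_space P" "prob_space Q" and sets: "sets P = sets Q"
    and \<phi>: "integrable P \<phi>" and int: "integrable Q (\<lambda>x. exp (\<phi> x))" "(\<integral>x. exp (\<phi> x) \<partial>Q) \<le> 1"
  shows "ereal (\<integral>x. \<phi> x \<partial>P) \<le> KL_ext P Q"
proof (cases "absolutely_continuous Q P \<and> integrable P (entropy_density (exp 1) Q P)")
  case True
  interpret Q: prob_space Q by fact
  interpret P: prob_space P by fact
  have "finite_measure P" by unfold_locales
  from Q.real_RN_deriv[OF this _ sets] True obtain D
    where D[measurable]: "D \<in> borel_measurable Q" and D': "AE x in Q. RN_deriv Q P x = ennreal (D x)"
      "AE x in P. 0 < D x" "\<And>x. 0 \<le> D x"
    by auto
  have "P = density Q (RN_deriv Q P)"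
    using True sets by (intro Q.density_RN_deriv[symmetric]) auto
  also have "\<dots> = density Q D"
    using D' by (auto intro!: density_cong)
  finally have P: "P = density Q D" .
  have [measurable]: "\<phi> \<in> borel_measurable Q"
    using borel_measurable_integrable[OF \<phi>] measurable_cong_sets[OF sets refl] by blast
  have ac: "AE x in P. RN_deriv Q P x = ennreal (D x)"
    using absolutely_continuous_AE[OF sets _ D'(1)] True by simp
  have eq: "AE x in P. entropy_density (exp 1) Q P x = ln (D x)"
    using ac by eventually_elim (simp add: entropy_density_def D'(3) log_def)
  have "integrable P (\<lambda>x. ln (D x)) \<longleftrightarrow> integrable P (entropy_density (exp 1) Q P)"
    using eq by (intro integrable_cong_AE) (auto simp: P)
  then have "integrable (density Q D) (\<lambda>x. ln (D x))"
    using True P by simp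
  then have iD: "integrable Q (\<lambda>x. D x * ln (D x))"
    using D'(3) by (subst (asm) integrable_real_density) auto
  have i\<phi>: "integrable Q (\<lambda>x. D x * \<phi> x)"
    using \<phi> D'(3) unfolding P by (subst (asm) integrable_real_density) auto
  have "integrable (density Q D) (\<lambda>x. 1::real)"
    using P P.integrable_const by metis
  then have i1: "integrable Q D"
    using D'(3) by (subst (asm) integrable_real_density) auto
  have "(\<integral>x. 1 \<partial>density Q D) = (1::real)"
    using P P.prob_space by simp
  then have one: "(\<integral>x. D x \<partial>Q) = 1"
    using D'(3) by (subst (asm) integral_real_density) auto
  \<comment> \<open>Young's inequality for the conjugate pair \<open>d * ln d - d\<close> and
    \<open>exp p\<close>; for positive \<open>d\<close> it is \<open>1 + s \<le> exp s\<close> at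
    \<open>s = p - ln d\<close>.\<close>
  have young: "d * p + d - exp p \<le> d * ln d" if "0 \<le> d" for d p :: real
  proof (cases "d = 0")
    case False
    then have "exp p = d * exp (p - ln d)"
      using that by (simp add: exp_diff)
    moreover have "d * (1 + (p - ln d)) \<le> d * exp (p - ln d)"
      using that by (intro mult_left_mono) auto
    ultimately show ?thesis
      by (simp add: algebra_simps)
  qed simp
  have "(\<integral>x. \<phi> x \<partial>P) = (\<integral>x. D x * \<phi> x \<partial>Q)"
    unfolding P using D'(3) by (subst integral_real_density) auto
  \<comment> \<open>The added terms integrate to 1 minus the integral of
    \<open>exp (\<phi> x)\<close>, which is nonnegative.\<close>
  also have "\<dots> \<le> (\<integral>x. D x * \<phi> x + D x - exp (\<phi> x) \<partial>Q)"
    using i\<phi> i1 int one by simp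
  also have "\<dots> \<le> (\<integral>x. D x * ln (D x) \<partial>Q)"
    using i\<phi> i1 int(1) iD young D'(3) by (intro integral_mono) auto
  also have "\<dots> = KL_divergence (exp 1) Q P"
    unfolding P using D'(3) by (subst Q.KL_density) (auto simp: log_def)
  finally show ?thesis
    using True by (simp add: KL_ext_def)
next
  case False
  then show ?thesis
    unfolding KL_ext_def by (simp only: if_False) simp
qed

text \<open>The equality case of the Gibbs bound: the log-density of \<open>P\<close> is
  \<open>\<phi>\<close> itself.\<close>

lemma KL_ext_density_exp:
  assumes "prob_space Q" and [measurable]: "\<phi> \<in> borel_measurable Q"
    and P: "P = density Q (\<lambda>x. ennreal (exp (\<phi> x)))" and "prob_space P"
    and i: "integrable P \<phi>"
  shows "KL_ext P Q = ereal (\<integral>x. \<phi> x \<partial>P)"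
proof -
  interpret Q: prob_space Q by fact
  interpret P: prob_space P by fact
  have "AE x in Q. ennreal (exp (\<phi> x)) = RN_deriv Q P x"
    by (rule Q.RN_deriv_unique) (auto simp: P)
  then have "AE x in Q. entropy_density (exp 1) Q P x = \<phi> x"
    by eventually_elim (subst (asm) eq_commute, simp add: entropy_density_def log_def)
  then have ae: "AE x in P. entropy_density (exp 1) Q P x = \<phi> x"
    unfolding P by (subst AE_density) auto
  have "absolutely_continuous Q P"
    unfolding P by (intro absolutely_continuousI_density) auto
  moreover have "entropy_density (exp 1) Q P \<in> borel_measurable P"
    by (simp add: P)
  then have "integrable P (entropy_density (exp 1) Q P)"
    using ae i by (subst integrable_cong_AE[where g = \<phi>]) auto
  moreover have "KL_divergence (exp 1) Q P = (\<integral>x. \<phi> x \<partial>P)"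
    unfolding KL_divergence_def using ae i by (intro integral_cong_AE) (auto simp: P)
  ultimately show ?thesis
    by (simp add: KL_ext_def)
qed

section \<open>Couplings and their marginals\<close>

lemma integrable_coupling:
  fixes f :: "'a \<Rightarrow> real" and g :: "'b \<Rightarrow> real"
  assumes "\<pi> \<in> couplings \<mu> \<nu>"
  shows "integrable \<mu> f \<Longrightarrow> integrable \<pi> (\<lambda>z. f (fst z))"
    and "integrable \<nu> g \<Longrightarrow> integrable \<pi> (\<lambda>z. g (snd z))"
    and "integrable \<mu> f \<Longrightarrow> (\<integral>z. f (fst z) \<partial>\<pi>) = (\<integral>x. f x \<partial>\<mu>)"
    and "integrable \<nu> g \<Longrightarrow> (\<integral>z. g (snd z) \<partial>\<pi>) = (\<integral>y. g y \<partial>\<nu>)"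
proof -
  have s: "sets \<pi> = sets (\<mu> \<Otimes>\<^sub>M \<nu>)" and d: "distr \<pi> \<mu> fst = \<mu>" "distr \<pi> \<nu> snd = \<nu>"
    using assms by (auto simp: couplings_def)
  have m: "fst \<in> measurable \<pi> \<mu>" "snd \<in> measurable \<pi> \<nu>"
    using measurable_cong_sets[OF s refl] by auto
  show "integrable \<mu> f \<Longrightarrow> integrable \<pi> (\<lambda>z. f (fst z))"
    using integrable_distr[OF m(1), of f] d by simp
  show "integrable \<nu> g \<Longrightarrow> integrable \<pi> (\<lambda>z. g (snd z))"
    using integrable_distr[OF m(2), of g] d by simp
  show "integrable \<mu> f \<Longrightarrow> (\<integral>z. f (fst z) \<partial>\<pi>) = (\<integral>x. f x \<partial>\<mu>)"
    using integral_distr[OF m(1), of f] d by auto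
  show "integrable \<nu> g \<Longrightarrow> (\<integral>z. g (snd z) \<partial>\<pi>) = (\<integral>y. g y \<partial>\<nu>)"
    using integral_distr[OF m(2), of g] d by auto
qed

text \<open>By Tonelli, integrating out one variable over a cylinder set leaves the indicator of its
  base. For a Gibbs density \<open>h\<close> the two conditions form the Schroedinger
  system.\<close>

lemma density_in_couplings:
  assumes "prob_space \<mu>" "prob_space \<nu>"
    and [measurable]: "h \<in> borel_measurable (\<mu> \<Otimes>\<^sub>M \<nu>)"
    and 1: "AE x in \<mu>. (\<integral>\<^sup>+y. h (x, y) \<partial>\<nu>) = 1"
    and 2: "AE y in \<nu>. (\<integral>\<^sup>+x. h (x, y) \<partial>\<mu>) = 1"
  shows "density (\<mu> \<Otimes>\<^sub>M \<nu>) h \<in> couplings \<mu> \<nu>"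
proof -
  interpret M: prob_space \<mu> by fact
  interpret N: prob_space \<nu> by fact
  interpret pair_prob_space \<mu> \<nu> by unfold_locales
  have "emeasure (distr (density (\<mu> \<Otimes>\<^sub>M \<nu>) h) \<mu> fst) A = emeasure \<mu> A" if [measurable]: "A \<in> sets \<mu>" for A
  proof -
    have "emeasure (distr (density (\<mu> \<Otimes>\<^sub>M \<nu>) h) \<mu> fst) A
        = (\<integral>\<^sup>+z. h z * indicator A (fst z) \<partial>(\<mu> \<Otimes>\<^sub>M \<nu>))"
      by (subst emeasure_distr) (auto simp: emeasure_density indicator_def intro!: nn_integral_cong)
    also have "\<dots> = (\<integral>\<^sup>+x. \<integral>\<^sup>+y. h (x, y) * indicator A x \<partial>\<nu> \<partial>\<mu>)"
      by (subst N.nn_integral_fst[symmetric]) auto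
    also have "\<dots> = (\<integral>\<^sup>+x. indicator A x \<partial>\<mu>)"
      using 1 by (intro nn_integral_cong_AE) (auto simp: nn_integral_multc)
    finally show ?thesis by simp
  qed
  moreover have "emeasure (distr (density (\<mu> \<Otimes>\<^sub>M \<nu>) h) \<nu> snd) A = emeasure \<nu> A" if [measurable]: "A \<in> sets \<nu>" for A
  proof -
    have "emeasure (distr (density (\<mu> \<Otimes>\<^sub>M \<nu>) h) \<nu> snd) A
        = (\<integral>\<^sup>+z. h z * indicator A (snd z) \<partial>(\<mu> \<Otimes>\<^sub>M \<nu>))"
      by (subst emeasure_distr) (auto simp: emeasure_density indicator_def intro!: nn_integral_cong)
    also have "\<dots> = (\<integral>\<^sup>+y. \<integral>\<^sup>+x. h (x, y) * indicator A y \<partial>\<mu> \<partial>\<nu>)"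
      by (subst nn_integral_snd[symmetric]) auto
    also have "\<dots> = (\<integral>\<^sup>+y. indicator A y \<partial>\<nu>)"
      using 2 by (intro nn_integral_cong_AE) (auto simp: nn_integral_multc)
    finally show ?thesis by simp
  qed
  ultimately show ?thesis
    by (auto simp: couplings_def intro!: measure_eqI)
qed

section \<open>Optimality certificate from Schroedinger potentials\<close>

text \<open>Put \<open>\<phi> = (u + v - c) / \<epsilon>\<close>. Marginals fix the integrals of
  \<open>u\<close> and \<open>v\<close>, so at a coupling of finite cost the objective is the
  claimed value plus \<open>\<epsilon>\<close> times (KL minus the integral of
  \<open>\<phi>\<close>). The Gibbs bound makes this excess nonnegative, and it vanishes at the
  density \<open>exp \<phi>\<close>, a coupling by the Schroedinger system.\<close>

theorem entropic_OT_eq_potentials: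
  fixes c :: "'a \<Rightarrow> 'a \<Rightarrow> real" and u v :: "'a \<Rightarrow> real"
  assumes "\<epsilon> > 0" and pr: "prob_space \<mu>" "prob_space \<nu>"
    and c[measurable]: "(\<lambda>z. c (fst z) (snd z)) \<in> borel_measurable (\<mu> \<Otimes>\<^sub>M \<nu>)" and c0: "\<And>x y. 0 \<le> c x y"
    and u: "integrable \<mu> u" and v: "integrable \<nu> v"
    and 1: "AE x in \<mu>. (\<integral>\<^sup>+y. ennreal (exp ((u x + v y - c x y) / \<epsilon>)) \<partial>\<nu>) = 1"
    and 2: "AE y in \<nu>. (\<integral>\<^sup>+x. ennreal (exp ((u x + v y - c x y) / \<epsilon>)) \<partial>\<mu>) = 1"
  shows "entropic_OT (\<lambda>x y. ennreal (c x y)) \<epsilon> \<mu> \<nu> = ereal ((\<integral>x. u x \<partial>\<mu>) + (\<integral>y. v y \<partial>\<nu>))"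
proof -
  interpret M: prob_space \<mu> by fact
  interpret N: prob_space \<nu> by fact
  interpret pair_prob_space \<mu> \<nu> by unfold_locales
  let ?Q = "\<mu> \<Otimes>\<^sub>M \<nu>"
  have Q: "prob_space ?Q" by unfold_locales
  have [measurable]: "u \<in> borel_measurable \<mu>" "v \<in> borel_measurable \<nu>"
    using u v by auto
  define \<phi> where "\<phi> z = (u (fst z) + v (snd z) - c (fst z) (snd z)) / \<epsilon>" for z
  have \<phi>[measurable]: "\<phi> \<in> borel_measurable ?Q"
    unfolding \<phi>_def by measurable
  define P where "P = density ?Q (\<lambda>z. ennreal (exp (\<phi> z)))"
  have Pc: "P \<in> couplings \<mu> \<nu>"
    unfolding P_def using 1 2 by (intro density_in_couplings[OF pr]) (auto simp: \<phi>_def)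
  have P: "prob_space P"
    by (rule prob_space_coupling[OF pr(1) Pc])
  \<comment> \<open>The normalisation required by the Gibbs bound is the total mass of the coupling
    \<open>P\<close>.\<close>
  have "(\<integral>\<^sup>+z. ennreal (exp (\<phi> z)) \<partial>?Q) = emeasure P (space P)"
    by (simp add: P_def emeasure_density cong: nn_integral_cong)
  also have "\<dots> = 1" by (rule prob_space.emeasure_space_1[OF P])
  finally have nn1: "(\<integral>\<^sup>+z. ennreal (exp (\<phi> z)) \<partial>?Q) = ennreal 1" by simp
  then have e: "integrable ?Q (\<lambda>z. exp (\<phi> z))" "(\<integral>z. exp (\<phi> z) \<partial>?Q) = 1"
    by (subst (asm) nn_integral_eq_integrable; simp)+
  have cost: "enn2ereal (\<integral>\<^sup>+z. ennreal (c (fst z) (snd z)) \<partial>\<pi>)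
      = ereal ((\<integral>x. u x \<partial>\<mu>) + (\<integral>y. v y \<partial>\<nu>) - \<epsilon> * (\<integral>z. \<phi> z \<partial>\<pi>))"
    "integrable \<pi> \<phi>"
    if \<pi>: "\<pi> \<in> couplings \<mu> \<nu>" and i: "integrable \<pi> (\<lambda>z. c (fst z) (snd z))" for \<pi>
  proof -
    note [simp] = integrable_coupling[OF \<pi>] u v
    show "integrable \<pi> \<phi>"
      unfolding \<phi>_def using i by auto
    have "(\<integral>z. \<phi> z \<partial>\<pi>) = ((\<integral>x. u x \<partial>\<mu>) + (\<integral>y. v y \<partial>\<nu>) - (\<integral>z. c (fst z) (snd z) \<partial>\<pi>)) / \<epsilon>"
      unfolding \<phi>_def using i by (simp)
    then show "enn2ereal (\<integral>\<^sup>+z. ennreal (c (fst z) (snd z)) \<partial>\<pi>)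
      = ereal ((\<integral>x. u x \<partial>\<mu>) + (\<integral>y. v y \<partial>\<nu>) - \<epsilon> * (\<integral>z. \<phi> z \<partial>\<pi>))"
      using i c0 \<open>\<epsilon> > 0\<close> by (simp add: nn_integral_eq_integral enn2ereal_ennreal)
  qed
  have "entropic_OT (\<lambda>x y. ennreal (c x y)) \<epsilon> \<mu> \<nu> \<ge> ereal ((\<integral>x. u x \<partial>\<mu>) + (\<integral>y. v y \<partial>\<nu>))"
    unfolding entropic_OT_def
  proof (rule INF_greatest)
    fix \<pi> assume \<pi>: "\<pi> \<in> couplings \<mu> \<nu>"
    have s: "sets \<pi> = sets ?Q"
      using \<pi> by (simp add: couplings_def)
    have p: "prob_space \<pi>" by (rule prob_space_coupling[OF pr(1) \<pi>])
    have cm: "(\<lambda>z. c (fst z) (snd z)) \<in> borel_measurable \<pi>"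
      using c measurable_cong_sets[OF s refl] by blast
    show "ereal ((\<integral>x. u x \<partial>\<mu>) + (\<integral>y. v y \<partial>\<nu>))
        \<le> enn2ereal (\<integral>\<^sup>+z. ennreal (c (fst z) (snd z)) \<partial>\<pi>) + ereal \<epsilon> * KL_ext \<pi> ?Q"
    proof (cases "integrable \<pi> (\<lambda>z. c (fst z) (snd z))")
      case True
      have "ereal (\<integral>z. \<phi> z \<partial>\<pi>) \<le> KL_ext \<pi> ?Q"
        using cost(2)[OF \<pi> True] e by (intro KL_ext_ge_Gibbs[OF p Q s]) auto
      then have "ereal \<epsilon> * ereal (\<integral>z. \<phi> z \<partial>\<pi>) \<le> ereal \<epsilon> * KL_ext \<pi> ?Q"
        using \<open>\<epsilon> > 0\<close> by (intro ereal_mult_left_mono) auto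
      then have "ereal ((\<integral>x. u x \<partial>\<mu>) + (\<integral>y. v y \<partial>\<nu>) - \<epsilon> * (\<integral>z. \<phi> z \<partial>\<pi>)) + ereal \<epsilon> * ereal (\<integral>z. \<phi> z \<partial>\<pi>)
          \<le> ereal ((\<integral>x. u x \<partial>\<mu>) + (\<integral>y. v y \<partial>\<nu>) - \<epsilon> * (\<integral>z. \<phi> z \<partial>\<pi>)) + ereal \<epsilon> * KL_ext \<pi> ?Q"
        by (rule add_left_mono)
      then show ?thesis
        unfolding cost(1)[OF \<pi> True] by simp
    next
      \<comment> \<open>The transport cost is infinite here, and a nonnegative entropy term cannot
        cancel it.\<close>
      case False
      then have "(\<integral>\<^sup>+z. ennreal (c (fst z) (snd z)) \<partial>\<pi>) = \<infinity>"
        using cm c0 by (simp add: integrable_iff_bounded less_top[symmetric])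
      moreover have "0 \<le> ereal \<epsilon> * KL_ext \<pi> ?Q"
        using KL_ext_nonneg[OF p Q s] \<open>\<epsilon> > 0\<close> by simp
      ultimately show ?thesis
        by (cases "ereal \<epsilon> * KL_ext \<pi> ?Q") auto
    qed
  qed
  moreover have "entropic_OT (\<lambda>x y. ennreal (c x y)) \<epsilon> \<mu> \<nu> \<le> ereal ((\<integral>x. u x \<partial>\<mu>) + (\<integral>y. v y \<partial>\<nu>))"
  proof -
    \<comment> \<open>\<open>c\<close> is \<open>P\<close>-integrable without further assumptions, since \<open>t exp t\<close> is bounded below
      and \<open>\<phi>\<close> is bounded above by the integrable function \<open>(u + v) / \<epsilon>\<close>.\<close>
    have bound: "\<bar>exp p * p\<bar> \<le> exp p * \<bar>q\<bar> + 1" if "p \<le> q" for p q :: real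
    proof (cases "0 \<le> p")
      case True
      then show ?thesis using that by (simp add: abs_mult add_increasing2)
    next
      case False
      have "exp p * - p \<le> exp p * exp (- p)"
        using exp_ge_add_one_self[of "-p"] by (intro mult_left_mono) simp_all
      then have "exp p * - p \<le> 1" by (simp add: exp_minus)
      moreover have "0 \<le> exp p * \<bar>q\<bar>" by simp
      ultimately have "exp p * - p \<le> exp p * \<bar>q\<bar> + 1" by linarith
      then show ?thesis using False by (simp add: abs_mult)
    qed
    have "integrable P (\<lambda>z. (u (fst z) + v (snd z)) / \<epsilon>)"
      using integrable_coupling[OF Pc] u v by auto
    then have "integrable ?Q (\<lambda>z. exp (\<phi> z) * ((u (fst z) + v (snd z)) / \<epsilon>))"
      unfolding P_def by (subst (asm) integrable_real_density) auto
    from integrable_abs[OF this]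
    have "integrable ?Q (\<lambda>z. exp (\<phi> z) * \<bar>(u (fst z) + v (snd z)) / \<epsilon>\<bar>)"
      by (simp add: abs_mult)
    then have "integrable ?Q (\<lambda>z. exp (\<phi> z) * \<bar>(u (fst z) + v (snd z)) / \<epsilon>\<bar> + 1)"
      by simp
    then have "integrable ?Q (\<lambda>z. exp (\<phi> z) * \<phi> z)"
    proof (rule Bochner_Integration.integrable_bound)
      have "\<phi> z \<le> (u (fst z) + v (snd z)) / \<epsilon>" for z
        unfolding \<phi>_def using c0 \<open>\<epsilon> > 0\<close> by (intro divide_right_mono) auto
      from bound[OF this]
      show "AE z in ?Q. norm (exp (\<phi> z) * \<phi> z) \<le> norm (exp (\<phi> z) * \<bar>(u (fst z) + v (snd z)) / \<epsilon>\<bar> + 1)"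
        by (intro AE_I2) (simp add: order_trans[OF _ abs_ge_self])
    qed measurable
    then have i: "integrable P \<phi>"
      unfolding P_def by (subst integrable_real_density) auto
    \<comment> \<open>The integrand is \<open>c\<close> expressed through the potentials.\<close>
    then have "integrable P (\<lambda>z. u (fst z) + v (snd z) - \<epsilon> * \<phi> z)"
      using integrable_coupling[OF Pc] u v by auto
    then have "integrable P (\<lambda>z. c (fst z) (snd z))"
      using \<open>\<epsilon> > 0\<close> by (simp add: \<phi>_def)
    note cost = cost(1)[OF Pc this]
    have "KL_ext P ?Q = ereal (\<integral>z. \<phi> z \<partial>P)"
      by (rule KL_ext_density_exp[OF Q \<phi> P_def P i])
    then show ?thesis
      unfolding entropic_OT_def by (intro INF_lower2[OF Pc]) (simp add: cost)
  qed
  ultimately show ?thesis by (rule antisym[rotated])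
qed

section \<open>Symmetric two-point measures\<close>

text \<open>The push-forward of a fair coin also covers \<open>a = 0\<close>, where both atoms merge
  into the Dirac mass at 0.\<close>

definition two_point :: "real \<Rightarrow> real measure" where
  "two_point a = distr (measure_pmf (bernoulli_pmf (1/2))) borel (\<lambda>b. if b then a else - a)"

lemma sets_two_point [simp, measurable_cong]: "sets (two_point a) = sets borel"
  by (simp add: two_point_def)

lemma prob_space_two_point: "prob_space (two_point a)"
  unfolding two_point_def by (intro measure_pmf.prob_space_distr) simp

lemma nn_integral_two_point:
  assumes [measurable]: "f \<in> borel_measurable borel"
  shows "(\<integral>\<^sup>+x. f x \<partial>two_point a) = f a / 2 + f (- a) / 2"
  by (simp add: two_point_def nn_integral_distr ennreal_divide_times divide_ennreal_def)

lemma integrable_two_point: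
  fixes f :: "real \<Rightarrow> real"
  assumes [measurable]: "f \<in> borel_measurable borel"
  shows "integrable (two_point a) f"
  by (simp add: two_point_def integrable_distr_eq integrable_measure_pmf_finite)

lemma integral_two_point:
  fixes f :: "real \<Rightarrow> real"
  assumes [measurable]: "f \<in> borel_measurable borel"
  shows "(\<integral>x. f x \<partial>two_point a) = (f a + f (- a)) / 2"
  by (simp add: two_point_def integral_distr)

lemma AE_two_point:
  assumes [measurable]: "Measurable.pred borel P" and "P a" "P (- a)"
  shows "AE x in two_point a. P x"
  unfolding two_point_def using assms by (subst AE_distr_iff) auto

lemma two_point_in_prob_measures2: "two_point a \<in> prob_measures2"
  by (simp add: prob_measures2_def prob_space_two_point integrable_two_point)

text \<open>The potentials are \<open>u x = x^2 - k\<close> and \<open>v y = y^2\<close>. Their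
  squares cancel those of the cost, leaving the Gibbs density
  \<open>exp (2 * x * y / \<epsilon>) / cosh (2 * a * b / \<epsilon>)\<close>, whose average over
  either sign is 1 at the atoms.\<close>

lemma entropic_OT_two_point:
  assumes "\<epsilon> > 0"
  shows "entropic_OT quadratic_cost \<epsilon> (two_point a) (two_point b)
    = ereal (a\<^sup>2 + b\<^sup>2 - \<epsilon> * ln (cosh (2 * a * b / \<epsilon>)))"
proof -
  define k where "k = \<epsilon> * ln (cosh (2 * a * b / \<epsilon>))"
  have pot: "(x\<^sup>2 - k + y\<^sup>2 - \<bar>x - y\<bar>\<^sup>2) / \<epsilon> = 2 * x * y / \<epsilon> - ln (cosh (2 * a * b / \<epsilon>))" for x y
    using assms by (simp add: k_def field_simps power2_eq_square)
  \<comment> \<open>At each atom of either marginal, the Schroedinger equation is this identity with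
    \<open>t = 2 * a * b / \<epsilon>\<close>, up to swapping the summands.\<close>
  have half: "ennreal (exp (t - ln (cosh t))) / 2 + ennreal (exp (- t - ln (cosh t))) / 2 = 1" for t :: real
  proof -
    have "ennreal (exp (t - ln (cosh t))) / 2 + ennreal (exp (- t - ln (cosh t))) / 2
        = ennreal (exp (t - ln (cosh t)) / 2 + exp (- t - ln (cosh t)) / 2)"
      by (simp flip: ennreal_plus ennreal_numeral add: divide_ennreal)
    also have "exp (t - ln (cosh t)) / 2 + exp (- t - ln (cosh t)) / 2 = 1"
      using cosh_real_pos[of t] by (simp add: exp_diff field_simps) (simp add: cosh_field_def)
    finally show ?thesis by simp
  qed
  let ?t = "2 * a * b / \<epsilon>"
  have "entropic_OT (\<lambda>x y. ennreal (\<bar>x - y\<bar>\<^sup>2)) \<epsilon> (two_point a) (two_point b)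
      = ereal ((\<integral>x. x\<^sup>2 - k \<partial>two_point a) + (\<integral>y. y\<^sup>2 \<partial>two_point b))"
  proof (rule entropic_OT_eq_potentials)
    show "AE x in two_point a. (\<integral>\<^sup>+ y. ennreal (exp ((x\<^sup>2 - k + y\<^sup>2 - \<bar>x - y\<bar>\<^sup>2) / \<epsilon>)) \<partial>two_point b) = 1"
      unfolding pot
      by (rule AE_two_point; (subst nn_integral_two_point)?) (use half[of ?t] in \<open>simp_all add: add.commute\<close>)
    show "AE y in two_point b. (\<integral>\<^sup>+ x. ennreal (exp ((x\<^sup>2 - k + y\<^sup>2 - \<bar>x - y\<bar>\<^sup>2) / \<epsilon>)) \<partial>two_point a) = 1"
      unfolding pot
      by (rule AE_two_point; (subst nn_integral_two_point)?) (use half[of ?t] in \<open>simp_all add: add.commute\<close>)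
  qed (auto simp: assms prob_space_two_point intro!: integrable_two_point)
  also have "(\<lambda>x y. ennreal (\<bar>x - y\<bar>\<^sup>2)) = quadratic_cost"
    by (intro ext) (simp add: quadratic_cost_def)
  finally show ?thesis
    by (simp add: integral_two_point k_def)
qed

text \<open>The self-transport terms cancel the squares, so only the \<open>ln (cosh ...)\<close>
  terms survive.\<close>

lemma sinkhorn_divergence_two_point:
  assumes "\<epsilon> > 0"
  shows "real_of_ereal (sinkhorn_divergence quadratic_cost \<epsilon> (two_point a) (two_point b))
    = \<epsilon> / 2 * (ln (cosh (2 * a\<^sup>2 / \<epsilon>)) + ln (cosh (2 * b\<^sup>2 / \<epsilon>)) - 2 * ln (cosh (2 * a * b / \<epsilon>)))"
  unfolding sinkhorn_divergence_def entropic_OT_two_point[OF assms]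
  by (simp add: power2_eq_square algebra_simps)

section \<open>Numerical estimates and power inequalities\<close>

text \<open>Logarithms of \<open>exp t / 2 \<le> cosh t \<le> exp t\<close>.\<close>

lemma ln_cosh_bounds:
  assumes "0 \<le> t"
  shows "t - ln 2 \<le> ln (cosh t)" "ln (cosh t) \<le> (t::real)"
proof -
  have "ln (exp t / 2) \<le> ln (cosh t)"
    by (subst ln_le_cancel_iff) (auto simp: cosh_field_def add_pos_pos)
  then show "t - ln 2 \<le> ln (cosh t)"
    by (simp add: ln_div)
  have "ln (cosh t) \<le> ln (exp t)"
    using assms by (subst ln_le_cancel_iff) (auto simp: cosh_field_def add_pos_pos)
  then show "ln (cosh t) \<le> t" by simp
qed

text \<open>Since 2 is the geometric mean of 1/2 and 8, this is strict midpoint log-log concavity.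
  Numerically, the left side is at most \<open>0.2 * 8 = 1.6\<close> and the right side at least
  \<open>1.3^2 = 1.69\<close>.\<close>

lemma ln_cosh_log_concave_instance:
  "ln (cosh (1/2)) * ln (cosh 8) < (ln (cosh (2::real)))\<^sup>2"
proof -
  have "(exp (1/2))\<^sup>2 = exp (1::real)"
    by (simp flip: exp_double)
  \<comment> \<open>\<open>1.65^2 = 2.7225\<close> just exceeds the bound 2.72 on
    \<open>exp 1\<close>.\<close>
  also have "\<dots> \<le> (1.65)\<^sup>2"
    using e_less_272 by (simp add: power2_eq_square)
  finally have 1: "exp (1/2::real) \<le> 1.65"
    by (rule power2_le_imp_le) simp
  have "exp (1/2::real) \<ge> 1 + 1/2"
    by (rule exp_ge_add_one_self)
  then have "exp (- (1/2)::real) \<le> 2/3"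
    by (simp add: exp_minus field_simps)
  with 1 have "cosh (1/2::real) \<le> 1.2"
    by (simp add: cosh_field_def)
  then have a: "ln (cosh (1/2::real)) \<le> 0.2"
    using ln_le_minus_one[of "cosh (1/2::real)"] by simp
  then have "ln (cosh (1/2)) * ln (cosh (8::real)) \<le> 0.2 * 8"
    using cosh_real_ge_1 ln_cosh_bounds[of 8] by (intro mult_mono) auto
  moreover have "1.3 \<le> ln (cosh (2::real))"
    using ln_cosh_bounds[of 2] ln2_le_25_over_36 by simp
  then have "(1.3)\<^sup>2 \<le> (ln (cosh (2::real)))\<^sup>2"
    by (intro power_mono) auto
  ultimately show ?thesis
    by (simp add: power2_eq_square)
qed

text \<open>Split off one factor, \<open>z powr p = z * z powr (p - 1)\<close>, enlarge the
  remaining base to \<open>x + y\<close>, and sum over \<open>z = x\<close> and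
  \<open>z = y\<close>.\<close>

lemma powr_superadditive:
  fixes x y p :: real
  assumes "0 \<le> x" "0 \<le> y" "1 \<le> p"
  shows "x powr p + y powr p \<le> (x + y) powr p"
proof -
  have *: "z powr p \<le> z * (x + y) powr (p - 1)" if "0 \<le> z" "z \<le> x + y" for z
  proof -
    have "z powr p = z * z powr (p - 1)"
      using that by (cases "z = 0") (simp_all add: powr_diff)
    also have "\<dots> \<le> z * (x + y) powr (p - 1)"
      using that assms by (intro mult_left_mono powr_mono2) auto
    finally show ?thesis .
  qed
  have "x powr p + y powr p \<le> (x + y) * (x + y) powr (p - 1)"
    using *[of x] *[of y] assms by (simp add: distrib_right)
  also have "\<dots> = (x + y) powr p"
    using assms by (cases "x + y = 0") (simp_all add: powr_diff)
  finally show ?thesis .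
qed

section \<open>Failure of the triangle inequality\<close>

theorem theorem7p1:
  fixes \<epsilon> \<alpha> :: real
  assumes "\<epsilon> > 0" and "\<alpha> \<ge> 1/2"
  shows "\<exists>\<mu>\<^sub>0 \<in> prob_measures2. \<exists>\<mu>\<^sub>1 \<in> prob_measures2. \<exists>\<mu>\<^sub>2 \<in> prob_measures2.
    real_of_ereal (sinkhorn_divergence quadratic_cost \<epsilon> \<mu>\<^sub>0 \<mu>\<^sub>2) powr \<alpha>
      > real_of_ereal (sinkhorn_divergence quadratic_cost \<epsilon> \<mu>\<^sub>0 \<mu>\<^sub>1) powr \<alpha>
        + real_of_ereal (sinkhorn_divergence quadratic_cost \<epsilon> \<mu>\<^sub>1 \<mu>\<^sub>2) powr \<alpha>"
proof -
  define S where "S a b = real_of_ereal (sinkhorn_divergence quadratic_cost \<epsilon> (two_point a) (two_point b))" for a b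
  define l where "l t = ln (cosh t)" for t :: real
  \<comment> \<open>With \<open>s = sqrt \<epsilon> / 2\<close> and
    \<open>t = 2 * sqrt \<epsilon>\<close>, the arguments 8, 1/2 and 2 are
    \<open>2 * t^2 / \<epsilon>\<close>, \<open>2 * s^2 / \<epsilon>\<close> and
    \<open>2 * s * t / \<epsilon>\<close>.\<close>
  define A B C where "A = l 8" and "B = l (1/2)" and "C = l 2"
  note S_eq = sinkhorn_divergence_two_point[OF assms(1), folded S_def l_def]
  \<comment> \<open>Both divergences from the Dirac mass reduce to a single term because
    \<open>l 0 = 0\<close>.\<close>
  have S02: "S 0 (2 * sqrt \<epsilon>) = \<epsilon> / 2 * A"
    and S01: "S 0 (sqrt \<epsilon> / 2) = \<epsilon> / 2 * B"
    and S12: "S (sqrt \<epsilon> / 2) (2 * sqrt \<epsilon>) = \<epsilon> / 2 * (A + B - 2 * C)"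
    using assms(1) by (simp_all add: S_eq A_def B_def C_def l_def power_mult_distrib power_divide mult.left_commute[of "sqrt \<epsilon>"])
  have "0 < l t" if "0 < t" for t
    using cosh_real_strict_mono[of 0 t] that by (simp add: l_def)
  then have pos: "0 < A" "0 < B" "0 < C"
    by (simp_all add: A_def B_def C_def)
  have "B < A"
    by (simp add: A_def B_def l_def cosh_real_nonneg_less_iff)
  have key: "A * B < C\<^sup>2"
    using ln_cosh_log_concave_instance by (simp add: A_def B_def C_def l_def mult.commute)
  have "sqrt (A * B) < C"
    using key pos by (intro real_less_lsqrt) auto
  then have "A + B - 2 * C < (sqrt A - sqrt B)\<^sup>2"
    using pos by (simp add: power2_diff real_sqrt_mult)
  \<comment> \<open>This is the failure for exponent 1/2; \<open>B < A\<close> makes the right side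
    positive, so roots may be taken.\<close>
  then have lt: "sqrt (A + B - 2 * C) < sqrt A - sqrt B"
    using \<open>B < A\<close> by (intro real_less_lsqrt) auto
  \<comment> \<open>Nonnegativity of \<open>S12\<close>, checked directly:
    \<open>A \<ge> 8 - ln 2\<close> while \<open>2 * C \<le> 4\<close>.\<close>
  have "2 * C \<le> A + B"
    using ln_cosh_bounds(1)[of 8] ln_cosh_bounds(2)[of 2] ln2_le_25_over_36 pos(2)
    by (simp add: A_def C_def l_def)
  \<comment> \<open>Passing to square roots turns the exponent into
    \<open>2 * \<alpha> \<ge> 1\<close>, where superadditivity applies; the factor in
    \<open>\<epsilon>\<close> is common to all three terms.\<close>
  have sqrt_powr: "(\<epsilon> / 2 * x) powr \<alpha> = (\<epsilon> / 2) powr \<alpha> * sqrt x powr (2 * \<alpha>)" if "0 \<le> x" for x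
    using that assms(1) powr_mult[of "\<epsilon> / 2" x \<alpha>] by (simp add: powr_powr flip: powr_half_sqrt)
  have "sqrt B powr (2 * \<alpha>) + sqrt (A + B - 2 * C) powr (2 * \<alpha>)
      \<le> (sqrt B + sqrt (A + B - 2 * C)) powr (2 * \<alpha>)"
    using pos \<open>2 * C \<le> A + B\<close> assms(2) by (intro powr_superadditive) auto
  also have "\<dots> < sqrt A powr (2 * \<alpha>)"
    using lt pos \<open>2 * C \<le> A + B\<close> assms(2) by (intro powr_less_mono2) auto
  finally have "(\<epsilon> / 2 * B) powr \<alpha> + (\<epsilon> / 2 * (A + B - 2 * C)) powr \<alpha> < (\<epsilon> / 2 * A) powr \<alpha>"
    using pos \<open>2 * C \<le> A + B\<close> assms(1)
    by (simp only: sqrt_powr less_imp_le diff_ge_0_iff_ge flip: distrib_left) simp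
  then have "S 0 (sqrt \<epsilon> / 2) powr \<alpha> + S (sqrt \<epsilon> / 2) (2 * sqrt \<epsilon>) powr \<alpha> < S 0 (2 * sqrt \<epsilon>) powr \<alpha>"
    by (simp only: S01 S12 S02)
  then show ?thesis
    unfolding S_def using two_point_in_prob_measures2 by blast
qed

end
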